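(* Let $\mathcal{I}$ be an ideal on $\omega$. The following are equivalent: (1) $\mathcal{I}$ has the $\mathrm{FinBW}$ property; (2) for every sequence $(f_n)_{n\in\omega}$ of uniformly bounded continuous functions $f_n\colon\mathbb{R}\to\mathbb{R}$ there exist $A\in\mathcal{I}^+$ and a nonempty perfect set $P\subseteq\mathbb{R}$ such that the subsequence $(f_n\restriction P)_{n\in A}$ is uniformly convergent.
   Context: An ideal on $\omega$ is a family $\mathcal{I}\subseteq\mathcal{P}(\omega)$ with $\emptyset\in\mathcal{I}$, $\omega\notin\mathcal{I}$, closed under finite unions and subsets, containing all finite sets; $\mathcal{I}^+=\mathcal{P}(\omega)\setminus\mathcal{I}$. $\mathcal{I}$ has the $\mathrm{FinBW}$ property if for every sequence $(x_n)_{n\in\omega}$ in $[0,1]$ there is $A\in\mathcal{I}^+$ such that the subsequence $(x_n)_{n\in A}$ (indexed by $A$ in increasing order) converges. *)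

theory Defs
  imports "HOL-Analysis.Analysis" "HOL-Library.Infinite_Set"
begin

definition is_ideal :: "nat set set \<Rightarrow> bool" where
  "is_ideal I \<longleftrightarrow> {} \<in> I \<and> UNIV \<notin> I
     \<and> (\<forall>A B. A \<in> I \<longrightarrow> B \<in> I \<longrightarrow> A \<union> B \<in> I)
     \<and> (\<forall>A B. A \<in> I \<longrightarrow> B \<subseteq> A \<longrightarrow> B \<in> I)
     \<and> (\<forall>A. finite A \<longrightarrow> A \<in> I)"

definition ideal_pos :: "nat set set \<Rightarrow> nat set set" where
  "ideal_pos I = - I"

text \<open>The subsequence of s indexed by A in increasing order (A infinite).\<close>
definition subseq_on :: "(nat \<Rightarrow> 'a) \<Rightarrow> nat set \<Rightarrow> nat \<Rightarrow> 'a" where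
  "subseq_on s A = (\<lambda>k. s (enumerate A k))"

definition FinBW :: "nat set set \<Rightarrow> bool" where
  "FinBW I \<longleftrightarrow> (\<forall>x :: nat \<Rightarrow> real. (\<forall>n. x n \<in> {0..1}) \<longrightarrow>
      (\<exists>A \<in> ideal_pos I. convergent (subseq_on x A)))"

definition perfect_set :: "real set \<Rightarrow> bool" where
  "perfect_set P \<longleftrightarrow> closed P \<and> (\<forall>x \<in> P. x islimpt P)"

end

theory Submission
  imports Defs
begin

text \<open>For the forward direction, \<open>FinBW\<close> yields \<open>A \<in> I\<^sup>+\<close> along which \<open>f n q\<close> converges to some
  \<open>g q\<close> for every rational \<open>q\<close>: code countably many binary decisions about \<open>n\<close> into one ternary
  expansion. The upper semicontinuous envelope \<open>E\<close> of \<open>g\<close> is, up to \<open>e\<close>, equal to \<open>g y\<close> on a whole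
  ball around suitable rationals \<open>y\<close>, inside any given open set. A Cantor scheme of such balls
  controls \<open>f n\<close> for \<open>n\<close> beyond the threshold where \<open>f n y\<close> has settled near \<open>g y\<close>, and before the
  next splitting, where balls shrink by continuity of the finitely many \<open>f n\<close> seen so far; it
  has no control between a splitting and the next threshold. Two schemes running alternately
  cover each other's gaps, so they split \<open>A\<close> (up to a finite set) in two parts, on each of which
  \<open>f n\<close> tends to \<open>E\<close> uniformly on a perfect set. One of the parts is in \<open>I\<^sup>+\<close>.\<close>

section \<open>Convergence along an index set\<close>

abbreviation along :: "nat set \<Rightarrow> nat filter" where
  "along A \<equiv> inf sequentially (principal A)"

lemma eventually_along:
  "eventually P (along A) \<longleftrightarrow> (\<exists>N. \<forall>n\<in>A. N \<le> n \<longrightarrow> P n)"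
  unfolding eventually_inf_principal eventually_sequentially by auto

lemma along_neq_bot:
  assumes "infinite A"
  shows "along A \<noteq> bot"
  using assms unfolding trivial_limit_def eventually_along infinite_nat_iff_unbounded_le by blast

text \<open>Limits are handled with the filter \<open>along A\<close>, which restricts to a subset
  of \<open>A\<close> without reindexing. This lemma turns them at the end into limits of the
  increasing subsequence.\<close>

lemma filterlim_enumerate:
  assumes "infinite A"
  shows "filterlim (enumerate A) (along A) sequentially"
  unfolding filterlim_inf filterlim_principal
  using assms by (auto intro!: filterlim_subseq strict_mono_enumerate always_eventually enumerate_in_set)

lemma ideal_pos_infinite:
  assumes "is_ideal I" "A \<in> ideal_pos I"
  shows "infinite A"
  using assms unfolding is_ideal_def ideal_pos_def by auto

section \<open>Deciding countably many index sets by one convergent sequence\<close>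

text \<open>The leading term has size \<open>(1/3) ^ Suc l\<close>, and all later terms together
  reach at most half of that. In base 2 the tail could cancel the leading term, hence base
  3.\<close>

lemma ternary_sum_gap:
  fixes c :: "nat \<Rightarrow> real"
  assumes c: "\<And>j. \<bar>c j\<bar> \<le> 1" and cl: "\<bar>c l\<bar> = 1" and z: "\<And>j. j < l \<Longrightarrow> c j = 0"
  shows "(1/3) ^ Suc l / 2 \<le> \<bar>\<Sum>j. c j * (1/3) ^ Suc j\<bar>"
proof -
  define u where "u j = c j * (1/3) ^ Suc j" for j
  have le: "\<bar>u j\<bar> \<le> (1/3) ^ Suc j" for j
    using mult_right_mono[OF c[of j], of "(1/3) ^ Suc j"] by (simp add: u_def abs_mult)
  have summ: "summable u"
    by (rule summable_comparison_test[of _ "\<lambda>j. (1/3) ^ Suc j"])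
      (use le summable_geometric[of "1/3::real"] in \<open>auto simp: summable_Suc_iff\<close>)
  have geo: "(\<lambda>j. (1/3::real) ^ Suc (j + Suc l)) sums ((1/3) ^ Suc l / 2)"
    using sums_mult[OF geometric_sums[of "1/3::real"], of "(1/3) ^ Suc (Suc l)"]
    by (simp add: power_add mult_ac)
  have tail: "\<bar>\<Sum>j. u (j + Suc l)\<bar> \<le> (1/3) ^ Suc l / 2"
    using norm_suminf_le[of "\<lambda>j. u (j + Suc l)" "\<lambda>j. (1/3) ^ Suc (j + Suc l)"] le[of "_ + Suc l"] geo
    unfolding sums_iff real_norm_def by metis
  have "(\<Sum>j<Suc l. u j) = u l"
    using z by (simp add: u_def)
  then have "suminf u = (\<Sum>j. u (j + Suc l)) + u l"
    using suminf_split_initial_segment[OF summ, of "Suc l"] by simp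
  moreover have "\<bar>u l\<bar> = (1/3) ^ Suc l"
    using cl by (simp add: u_def abs_mult)
  ultimately show ?thesis
    using tail unfolding u_def by linarith
qed

text \<open>The memberships of \<open>n\<close> in the sets of \<open>X\<close> are the ternary
  digits of a real \<open>x n\<close>. Along an \<open>A\<close> where \<open>x\<close> converges,
  the values are eventually so close that each fixed digit is constant.\<close>

lemma FinBW_splitting:
  fixes X :: "nat set set"
  assumes I: "is_ideal I" "FinBW I" and X: "countable X"
  obtains A where "A \<in> ideal_pos I"
    "\<And>S. S \<in> X \<Longrightarrow> (\<forall>\<^sub>F n in along A. n \<in> S) \<or> (\<forall>\<^sub>F n in along A. n \<notin> S)"
proof -
  \<comment> \<open>Inserting the empty set makes the enumeration total even when \<open>X\<close>
    is empty; its extra digit is harmless.\<close>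
  define T where "T = from_nat_into (insert {} X)"
  have T: "range T = insert {} X"
    unfolding T_def using X by (intro range_from_nat_into) auto
  define b :: "nat \<Rightarrow> nat \<Rightarrow> real" where "b n j = of_bool (n \<in> T j)" for n j
  define x where "x n = (\<Sum>j. b n j * (1/3) ^ Suc j)" for n
  have geo: "(\<lambda>j. (1/3::real) ^ Suc j) sums (1/2)"
    using sums_mult[OF geometric_sums[of "1/3::real"], of "1/3"] by simp
  have bpos: "0 \<le> b n j * (1/3) ^ Suc j" "b n j * (1/3) ^ Suc j \<le> (1/3) ^ Suc j" for n j
    by (auto simp: b_def)
  have bsum: "summable (\<lambda>j. b n j * (1/3) ^ Suc j)" for n
    by (rule summable_comparison_test[of _ "\<lambda>j. (1/3) ^ Suc j"])
      (use bpos geo in \<open>auto simp: sums_iff b_def\<close>)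
  have "x n \<in> {0..1}" for n
  proof -
    have "0 \<le> x n" unfolding x_def by (intro suminf_nonneg bsum bpos)
    moreover have "x n \<le> (\<Sum>j. (1/3) ^ Suc j)"
      unfolding x_def using geo by (intro suminf_le bsum bpos) (auto simp: sums_iff)
    ultimately show ?thesis using geo by (simp add: sums_iff)
  qed
  then obtain A where A: "A \<in> ideal_pos I" and conv: "convergent (subseq_on x A)"
    using I(2) unfolding FinBW_def by blast
  have inf: "infinite A" using ideal_pos_infinite[OF I(1) A] .
  \<comment> \<open>Otherwise the first differing digit \<open>k\<close> satisfies
    \<open>k <= l\<close>, and the gap at \<open>k\<close> is at least the assumed bound at
    \<open>l\<close>.\<close>
  have agree: "n \<in> T l \<longleftrightarrow> m \<in> T l" if less: "\<bar>x n - x m\<bar> < (1/3) ^ Suc l / 2" for n m l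
  proof (rule ccontr)
    assume ne: "\<not> ?thesis"
    then obtain k where k: "(n \<in> T k) \<noteq> (m \<in> T k)"
      and below: "\<And>j. j < k \<Longrightarrow> (n \<in> T j) = (m \<in> T j)"
      using exists_least_iff[of "\<lambda>j. (n \<in> T j) \<noteq> (m \<in> T j)"] by blast
    have kl: "k \<le> l" using ne below[of l] by fastforce
    have "(1/3) ^ Suc k / 2 \<le> \<bar>\<Sum>j. (b n j - b m j) * (1/3) ^ Suc j\<bar>"
      by (rule ternary_sum_gap) (use k below in \<open>auto simp: b_def\<close>)
    also have "(\<Sum>j. (b n j - b m j) * (1/3) ^ Suc j) = x n - x m"
      unfolding x_def left_diff_distrib by (rule suminf_diff[OF bsum bsum, symmetric])
    finally show False
      using less power_decreasing[OF Suc_le_mono[THEN iffD2, OF kl], of "1/3::real"] by linarith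
  qed
  have "(\<forall>\<^sub>F n in along A. n \<in> S) \<or> (\<forall>\<^sub>F n in along A. n \<notin> S)" if S: "S \<in> X" for S
  proof -
    obtain l where l: "S = T l" using T S by blast
    have "Cauchy (subseq_on x A)" using conv by (rule convergent_Cauchy)
    then obtain K where "\<forall>i\<ge>K. \<forall>j\<ge>K. dist (subseq_on x A i) (subseq_on x A j) < (1/3) ^ Suc l / 2"
      using metric_CauchyD[of "subseq_on x A" "(1/3) ^ Suc l / 2"] by auto
    then have K: "\<bar>x (enumerate A i) - x (enumerate A K)\<bar> < (1/3) ^ Suc l / 2" if "i \<ge> K" for i
      using that by (simp add: subseq_on_def dist_real_def)
    have "n \<in> T l \<longleftrightarrow> enumerate A K \<in> T l" if n: "n \<in> A" "enumerate A K \<le> n" for n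
    proof -
      obtain i where "n = enumerate A i" using enumerate_Ex[OF inf n(1)] by metis
      then show ?thesis using K[of i] n(2) inf agree[of "enumerate A i" "enumerate A K" l] by simp
    qed
    then show ?thesis
      unfolding eventually_along l by metis
  qed
  then show ?thesis using A that by blast
qed

section \<open>Limits from rational cuts, and the semicontinuous envelope\<close>

text \<open>The limit is the supremum of the rationals that are eventually lower bounds. A rational
  above it is not eventually a lower bound, so \<open>thr\<close> makes it eventually a strict upper
  bound.\<close>

lemma tendsto_of_thresholds:
  fixes x :: "'a \<Rightarrow> real"
  assumes F: "F \<noteq> bot" and bdd: "\<And>n. \<bar>x n\<bar> \<le> M"
    and thr: "\<And>r. r \<in> \<rat> \<Longrightarrow> (\<forall>\<^sub>F n in F. r \<le> x n) \<or> (\<forall>\<^sub>F n in F. \<not> r \<le> x n)"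
  shows "\<exists>l. (x \<longlongrightarrow> l) F"
proof -
  define S where "S = {r \<in> \<rat>. \<forall>\<^sub>F n in F. r \<le> x n}"
  obtain q :: real where q: "q \<in> \<rat>" "q < -M"
    using Rats_dense_in_real[of "-M - 1" "-M"] by auto
  have "q \<le> x n" for n
    using bdd[of n] q(2) by linarith
  then have "q \<in> S"
    using q(1) by (simp add: S_def)
  then have ne: "S \<noteq> {}" by blast
  have "r \<le> M" if r: "r \<in> S" for r
  proof -
    obtain n where "r \<le> x n"
      using r eventually_happens'[OF F, of "\<lambda>n. r \<le> x n"] unfolding S_def by blast
    then show ?thesis using bdd[of n] by linarith
  qed
  then have ba: "bdd_above S" by (auto simp: bdd_above_def)
  have "(x \<longlongrightarrow> Sup S) F"
  proof (rule order_tendstoI)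
    fix a assume "a < Sup S"
    then obtain r where "r \<in> S" "a < r"
      using less_cSup_iff[OF ne ba] by blast
    then show "\<forall>\<^sub>F n in F. a < x n"
      unfolding S_def by (auto elim: eventually_mono)
  next
    fix a assume "Sup S < a"
    then obtain r where r: "r \<in> \<rat>" "Sup S < r" "r < a"
      using Rats_dense_in_real by blast
    then have "r \<notin> S"
      using cSup_upper[OF _ ba] by force
    then have "\<forall>\<^sub>F n in F. \<not> r \<le> x n"
      using thr[OF r(1)] r(1) by (auto simp: S_def)
    then show "\<forall>\<^sub>F n in F. x n < a"
      by eventually_elim (use r(3) in linarith)
  qed
  then show ?thesis ..
qed

text \<open>Among the nonempty open subsets of \<open>U\<close>, pick \<open>V\<close> whose
  supremum \<open>h V\<close> is within \<open>e / 2\<close> of the infimum \<open>c\<close>. For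
  \<open>z\<close> in \<open>V\<close>, every open neighbourhood of \<open>z\<close> can be cut down
  to a subset of \<open>V\<close>, so \<open>E z\<close> lies between \<open>c\<close> and
  \<open>h V\<close>. Any \<open>y\<close> in \<open>V\<close> with \<open>g y\<close> close to
  \<open>h V\<close> then serves as a centre.\<close>

lemma almost_continuous_envelope:
  fixes g :: "'a::metric_space \<Rightarrow> real"
  assumes dense: "\<And>U. open U \<Longrightarrow> U \<noteq> {} \<Longrightarrow> U \<inter> D \<noteq> {}"
    and bdd: "\<And>q. q \<in> D \<Longrightarrow> \<bar>g q\<bar> \<le> M"
  shows "\<exists>E. \<forall>U e. open U \<longrightarrow> U \<noteq> {} \<longrightarrow> 0 < e \<longrightarrow>
    (\<exists>y\<in>D. \<exists>d>0. cball y d \<subseteq> U \<and> (\<forall>z\<in>cball y d. \<bar>E z - g y\<bar> \<le> e))"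
proof -
  define h where "h V = Sup (g ` (V \<inter> D))" for V
  define E where "E z = Inf (h ` {V. open V \<and> z \<in> V})" for z
  have ba: "bdd_above (g ` (V \<inter> D))" for V
    using bdd by (intro bdd_aboveI[of _ M]) force
  have h_ge: "g q \<le> h V" if "q \<in> V" "q \<in> D" for q V
    unfolding h_def using that ba by (intro cSup_upper) auto
  have h_mono: "h V \<le> h W" if "open V" "V \<noteq> {}" "V \<subseteq> W" for V W
    unfolding h_def using that ba dense[of V] by (intro cSup_subset_mono) auto
  have h_low: "-M \<le> h V" if V: "open V" "V \<noteq> {}" for V
  proof -
    obtain q where "q \<in> V" "q \<in> D" using dense[OF V] by blast
    then show ?thesis using h_ge[of q V] bdd[of q] by linarith
  qed
  have "\<exists>y\<in>D. \<exists>d>0. cball y d \<subseteq> U \<and> (\<forall>z\<in>cball y d. \<bar>E z - g y\<bar> \<le> e)"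
    if U: "open U" "U \<noteq> {}" and e: "0 < e" for U e
  proof -
    define \<V> where "\<V> = {V. open V \<and> V \<noteq> {} \<and> V \<subseteq> U}"
    define c where "c = Inf (h ` \<V>)"
    have bb: "bdd_below (h ` \<V>)"
      using h_low by (intro bdd_belowI[of _ "-M"]) (auto simp: \<V>_def)
    have c_le: "c \<le> h V" if "V \<in> \<V>" for V
      unfolding c_def using that bb by (intro cInf_lower) auto
    have "h ` \<V> \<noteq> {}" using U by (auto simp: \<V>_def)
    then obtain V where V: "V \<in> \<V>" "h V < c + e / 2"
      using cInf_less_iff[OF _ bb, of "c + e / 2"] e unfolding c_def by auto
    have Vo: "open V" "V \<noteq> {}" "V \<subseteq> U" using V(1) by (auto simp: \<V>_def)
    have "g ` (V \<inter> D) \<noteq> {}" using dense[OF Vo(1,2)] by blast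
    then obtain y where y: "y \<in> V" "y \<in> D" "h V - e / 2 < g y"
      using less_cSup_iff[OF _ ba[of V], of "h V - e / 2"] e unfolding h_def by auto
    obtain d where d: "d > 0" "cball y d \<subseteq> V"
      using Vo(1) y(1) open_contains_cball by blast
    have "\<bar>E z - g y\<bar> \<le> e" if z: "z \<in> cball y d" for z
    proof -
      have zV: "z \<in> V" using z d by blast
      have "c \<le> h W" if W: "open W" "z \<in> W" for W
      proof -
        have "W \<inter> V \<in> \<V>" using W Vo zV by (auto simp: \<V>_def)
        then show ?thesis
          using c_le[of "W \<inter> V"] h_mono[of "W \<inter> V" W] by (auto simp: \<V>_def)
      qed
      then have "c \<le> E z"
        unfolding E_def by (intro cInf_greatest) auto
      moreover have "E z \<le> h V"
        unfolding E_def using zV Vo h_low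
        by (intro cInf_lower bdd_belowI[of _ "-M"]) auto
      moreover have "c \<le> h V" "g y \<le> h V" using c_le V(1) h_ge y by auto
      ultimately show ?thesis using V(2) y(3) by linarith
    qed
    then show ?thesis using y(2) d Vo(3) by blast
  qed
  then show ?thesis by blast
qed

section \<open>Perfect sets from Cantor schemes\<close>

text \<open>Every piece \<open>S\<close> has descendants at all later levels, so by compactness it
  contains a point of the intersection. Splitting then provides a second point of the intersection
  near any given one.\<close>

lemma perfect_fusion:
  fixes F :: "nat \<Rightarrow> real set set"
  assumes fin: "\<And>k. finite (F k)" and ne: "F 0 \<noteq> {}"
    and comp: "\<And>k S. S \<in> F k \<Longrightarrow> compact S \<and> S \<noteq> {}"
    and up: "\<And>k S. S \<in> F (Suc k) \<Longrightarrow> \<exists>T\<in>F k. S \<subseteq> T"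
    and split: "\<And>k S. S \<in> F k \<Longrightarrow>
      \<exists>T\<in>F (Suc k). \<exists>T'\<in>F (Suc k). T \<subseteq> S \<and> T' \<subseteq> S \<and> T \<inter> T' = {}"
    and diam: "\<And>k S x y. S \<in> F k \<Longrightarrow> x \<in> S \<Longrightarrow> y \<in> S \<Longrightarrow> dist x y \<le> \<delta> k" and \<delta>: "\<delta> \<longlonglongrightarrow> 0"
  shows "perfect_set (\<Inter>k. \<Union>(F k))" "(\<Inter>k. \<Union>(F k)) \<noteq> {}"
proof -
  define P where "P = (\<Inter>k. \<Union>(F k))"
  have compU: "compact (\<Union>(F k))" for k
    using fin comp by (intro compact_Union) auto
  have dec: "decseq (\<lambda>k. \<Union>(F k))"
    using up by (intro decseq_SucI) blast
  have desc: "\<exists>T\<in>F (k + j). T \<subseteq> S" if "S \<in> F k" for k j S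
  proof (induction j)
    case 0
    then show ?case using that by auto
  next
    case (Suc j)
    then show ?case using split by (metis add_Suc_right order_trans)
  qed
  have meets: "S \<inter> P \<noteq> {}" if S: "S \<in> F k" for k S
  proof -
    have "(\<Inter>j. S \<inter> \<Union>(F (k + j))) \<noteq> {}"
    proof (rule compact_nest)
      show "compact (S \<inter> \<Union>(F (k + j)))" for j
        using comp[OF S] compU by (intro compact_Int) auto
      show "S \<inter> \<Union>(F (k + j)) \<noteq> {}" for j
        using desc[OF S, of j] comp by blast
      show "S \<inter> \<Union>(F (k + j)) \<subseteq> S \<inter> \<Union>(F (k + i))" if "i \<le> j" for i j
        using decseqD[OF dec, of "k + i" "k + j"] that by auto
    qed
    then obtain z where "z \<in> (\<Inter>j. S \<inter> \<Union>(F (k + j)))" by blast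
    then have z: "z \<in> S" "\<And>j. z \<in> \<Union>(F (k + j))" by blast+
    have "z \<in> \<Union>(F j)" for j
      using z(2)[of j] decseqD[OF dec, of j "k + j"] by auto
    then show ?thesis using z(1) by (auto simp: P_def)
  qed
  then show "(\<Inter>k. \<Union>(F k)) \<noteq> {}"
    using ne unfolding P_def by blast
  have "z islimpt P" if z: "z \<in> P" for z
    unfolding islimpt_approachable
  proof (intro allI impI)
    fix e :: real assume "e > 0"
    then obtain k where k: "\<delta> k < e"
      using order_tendstoD(2)[OF \<delta>, of e] eventually_happens'[of sequentially] by auto
    obtain S where S: "S \<in> F k" "z \<in> S" using z by (auto simp: P_def)
    \<comment> \<open>Two disjoint pieces inside \<open>S\<close> cannot both contain
      \<open>z\<close>.\<close>
    obtain T where T: "T \<in> F (Suc k)" "T \<subseteq> S" "z \<notin> T"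
      using split[OF S(1)] by blast
    obtain w where w: "w \<in> T" "w \<in> P" using meets[OF T(1)] by blast
    then have "w \<noteq> z" "dist w z < e"
      using T diam[OF S(1), of w z] S(2) k by auto
    then show "\<exists>w\<in>P. w \<noteq> z \<and> dist w z < e" using w by blast
  qed
  moreover have "closed P"
    unfolding P_def using compU compact_imp_closed by blast
  ultimately show "perfect_set (\<Inter>k. \<Union>(F k))"
    unfolding perfect_set_def P_def by blast
qed

section \<open>Two interleaved Cantor schemes\<close>

locale interleaved_fusion =
  fixes f :: "nat \<Rightarrow> real \<Rightarrow> real" and g E :: "real \<Rightarrow> real" and D :: "real set" and A :: "nat set"
  assumes cont: "\<And>n. continuous_on UNIV (f n)"
    and lim: "\<And>q. q \<in> D \<Longrightarrow> ((\<lambda>n. f n q) \<longlongrightarrow> g q) (along A)"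
    and envelope: "\<And>U e. open U \<Longrightarrow> U \<noteq> {} \<Longrightarrow> 0 < e \<Longrightarrow>
      \<exists>y\<in>D. \<exists>d>0. cball y d \<subseteq> U \<and> (\<forall>z\<in>cball y d. \<bar>E z - g y\<bar> \<le> e)"
begin

text \<open>A ball is stored as centre and radius, since its centre is the sample point at which
  \<open>f n\<close> is compared with \<open>g\<close>.\<close>

abbreviation nball :: "real \<times> real \<Rightarrow> real set" where
  "nball s \<equiv> cball (fst s) (snd s)"

text \<open>For \<open>z\<close> in a child of a ball with centre \<open>y\<close>, the distance
  from \<open>f n z\<close> to \<open>E z\<close> is estimated through \<open>f n y\<close> and
  \<open>g y\<close>. The three errors are bounded by \<open>child\<close>, \<open>settled\<close>
  and \<open>node\<close> in this order.\<close>

definition node :: "real \<Rightarrow> real \<times> real \<Rightarrow> bool" where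
  "node e s \<longleftrightarrow> fst s \<in> D \<and> 0 < snd s \<and> snd s \<le> e \<and> (\<forall>z\<in>nball s. \<bar>E z - g (fst s)\<bar> \<le> e)"

definition child :: "nat \<Rightarrow> real \<Rightarrow> real \<times> real \<Rightarrow> real \<times> real \<Rightarrow> bool" where
  "child m e s t \<longleftrightarrow> nball t \<subseteq> nball s \<and> (\<forall>n<m. \<forall>z\<in>nball t. \<bar>f n z - f n (fst s)\<bar> \<le> e)"

definition refines :: "nat \<Rightarrow> real \<Rightarrow> (real \<times> real) set \<Rightarrow> (real \<times> real) set \<Rightarrow> bool" where
  "refines m e H H' \<longleftrightarrow> (\<forall>t\<in>H'. \<exists>s\<in>H. child m e s t) \<and>
     (\<forall>s\<in>H. \<exists>t\<in>H'. \<exists>u\<in>H'. nball t \<subseteq> nball s \<and> nball u \<subseteq> nball s \<and> nball t \<inter> nball u = {})"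

definition nodes :: "real \<Rightarrow> (real \<times> real) set \<Rightarrow> bool" where
  "nodes e H \<longleftrightarrow> finite H \<and> H \<noteq> {} \<and> (\<forall>s\<in>H. node e s)"

definition settled :: "nat \<Rightarrow> real \<Rightarrow> (real \<times> real) set \<Rightarrow> bool" where
  "settled N e H \<longleftrightarrow> (\<forall>n\<in>A. N \<le> n \<longrightarrow> (\<forall>s\<in>H. \<bar>f n (fst s) - g (fst s)\<bar> \<le> e))"

lemma node_exists:
  assumes "open U" "U \<noteq> {}" "0 < e"
  obtains s where "node e s" "nball s \<subseteq> U"
proof -
  obtain y d where y: "y \<in> D" "d > 0" "cball y d \<subseteq> U" "\<forall>z\<in>cball y d. \<bar>E z - g y\<bar> \<le> e"
    using envelope[OF assms] by blast
  have sub: "cball y (min d e) \<subseteq> cball y d" by auto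
  show ?thesis
    by (rule that[of "(y, min d e)"]) (use y sub assms(3) in \<open>auto simp: node_def\<close>)
qed

text \<open>By continuity the finitely many \<open>f n\<close> with \<open>n < m\<close> vary by
  less than \<open>e\<close> near the centre. One child is taken to the left of the centre and one
  to the right, which makes them disjoint.\<close>

lemma children_exist:
  assumes s: "node e s" and e: "0 < e" "0 < e'"
  obtains t u where "node e' t" "node e' u" "child m e s t" "child m e s u" "nball t \<inter> nball u = {}"
proof -
  define y where "y = fst s"
  define V where "V = ball y (snd s) \<inter> (\<Inter>n<m. {z. \<bar>f n z - f n y\<bar> < e})"
  have "open {z. \<bar>f n z - f n y\<bar> < e}" for n
    using cont by (intro open_Collect_less continuous_intros)
  then have "open V"
    unfolding V_def by (intro open_Int open_INT) auto
  moreover have "y \<in> V"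
    using s e by (simp add: V_def node_def)
  ultimately obtain d where d: "d > 0" "ball y d \<subseteq> V"
    using open_contains_ball by blast
  have V: "child m e s t" if "nball t \<subseteq> V" for t
    using that unfolding child_def V_def y_def by (fastforce simp: less_imp_le)
  obtain t where t: "node e' t" "nball t \<subseteq> {y-d<..<y}"
    using node_exists[of "{y-d<..<y}" e'] d(1) e(2) by auto
  obtain u where u: "node e' u" "nball u \<subseteq> {y<..<y+d}"
    using node_exists[of "{y<..<y+d}" e'] d(1) e(2) by auto
  have "{y-d<..<y} \<subseteq> V" "{y<..<y+d} \<subseteq> V"
    using d(2) by (auto simp: ball_eq_greaterThanLessThan)
  then have "child m e s t" "child m e s u"
    using V t(2) u(2) by blast+
  moreover have "nball t \<inter> nball u = {}"
    using t(2) u(2) by fastforce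
  ultimately show ?thesis using that t(1) u(1) by blast
qed

lemma refinement_exists:
  assumes H: "nodes e H" and e: "0 < e" "0 < e'"
  obtains H' where "nodes e' H'" "refines m e H H'"
proof -
  have "\<forall>s\<in>H. \<exists>t u. node e' t \<and> node e' u \<and> child m e s t \<and> child m e s u \<and> nball t \<inter> nball u = {}"
    using H children_exist[OF _ e, of _ m] unfolding nodes_def by metis
  then obtain a b where ab: "\<And>s. s \<in> H \<Longrightarrow> node e' (a s) \<and> node e' (b s) \<and>
      child m e s (a s) \<and> child m e s (b s) \<and> nball (a s) \<inter> nball (b s) = {}"
    by metis
  show ?thesis
  proof
    show "nodes e' (a ` H \<union> b ` H)"
      using H ab by (auto simp: nodes_def)
    show "refines m e H (a ` H \<union> b ` H)"
      unfolding refines_def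
    proof (intro conjI ballI)
      show "\<exists>s\<in>H. child m e s t" if "t \<in> a ` H \<union> b ` H" for t
        using that ab by blast
      show "\<exists>t\<in>a ` H \<union> b ` H. \<exists>u\<in>a ` H \<union> b ` H.
          nball t \<subseteq> nball s \<and> nball u \<subseteq> nball s \<and> nball t \<inter> nball u = {}" if "s \<in> H" for s
        using that ab[OF that]
        by (intro bexI[of _ "a s"] bexI[of _ "b s"]) (auto simp: child_def)
    qed
  qed
qed

lemma settled_exists:
  assumes "nodes e H" "0 < e"
  obtains N where "M < N" "settled N e H"
proof -
  have "\<forall>\<^sub>F n in along A. \<bar>f n (fst s) - g (fst s)\<bar> \<le> e" if "s \<in> H" for s
  proof -
    have "fst s \<in> D" using assms(1) that by (auto simp: nodes_def node_def)
    then have "\<forall>\<^sub>F n in along A. dist (f n (fst s)) (g (fst s)) < e"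
      using lim assms(2) tendstoD by blast
    then show ?thesis by eventually_elim (simp add: dist_real_def)
  qed
  then have "\<forall>\<^sub>F n in along A. \<forall>s\<in>H. \<bar>f n (fst s) - g (fst s)\<bar> \<le> e"
    using assms(1) by (intro eventually_ball_finite) (auto simp: nodes_def)
  then obtain N where "\<forall>n\<in>A. N \<le> n \<longrightarrow> (\<forall>s\<in>H. \<bar>f n (fst s) - g (fst s)\<bar> \<le> e)"
    unfolding eventually_along by blast
  then show ?thesis
    by (intro that[of "max N (Suc M)"]) (auto simp: settled_def)
qed

text \<open>Level \<open>j\<close> is refined to level \<open>j + 2\<close> only after the threshold \<open>r (Suc j)\<close> of level
  \<open>j + 1\<close> is known; thus the levels of one parity control the indices in \<open>{r j..<r (Suc j)}\<close>
  for \<open>j\<close> of that parity.\<close>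

lemma interleaved_levels:
  obtains X r where "\<And>j. nodes (inverse (Suc j)) (X j)" "\<And>j. settled (r j) (inverse (Suc j)) (X j)"
    "\<And>j. r j < r (Suc j)" "\<And>j. refines (r (Suc j)) (inverse (Suc j)) (X j) (X (Suc (Suc j)))"
proof -
  let ?e = "\<lambda>j. inverse (real (Suc j))"
  \<comment> \<open>A state at \<open>j\<close> holds level \<open>j\<close>, level
    \<open>j + 1\<close> and the threshold of level \<open>j\<close>. Having level
    \<open>j + 1\<close> at hand allows its threshold to be found before level \<open>j\<close> is
    refined.\<close>
  let ?P = "\<lambda>j (H, H', r). nodes (?e j) H \<and> nodes (?e (Suc j)) H' \<and> settled r (?e j) H"
  let ?Q = "\<lambda>j (H, H', r) (K, K', r'). K = H' \<and> r < r' \<and> refines r' (?e j) H K'"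
  have epos: "0 < ?e j" for j by simp
  have "\<exists>\<sigma>. \<forall>j. ?P j (\<sigma> j) \<and> ?Q j (\<sigma> j) (\<sigma> (Suc j))"
  proof (rule dependent_nat_choice)
    obtain s t where st: "node (?e 0) s" "node (?e (Suc 0)) t"
      using node_exists[of UNIV] epos by (metis open_UNIV UNIV_not_empty)
    then have n: "nodes (?e 0) {s}" "nodes (?e (Suc 0)) {t}" by (simp_all add: nodes_def)
    obtain N where "settled N (?e 0) {s}"
      using settled_exists[OF n(1) epos] by metis
    then show "\<exists>x. ?P 0 x"
      using n by (intro exI[of _ "({s}, {t}, N)"]) simp
  next
    fix x j assume x: "?P j x"
    obtain H H' r where xd: "x = (H, H', r)" by (cases x)
    have H: "nodes (?e j) H" "nodes (?e (Suc j)) H'" using x xd by auto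
    obtain r' where r': "r < r'" "settled r' (?e (Suc j)) H'"
      using settled_exists[OF H(2) epos] by metis
    obtain K' where "nodes (?e (Suc (Suc j))) K'" "refines r' (?e j) H K'"
      using refinement_exists[OF H(1) epos epos] by metis
    then show "\<exists>y. ?P (Suc j) y \<and> ?Q j x y"
      using H r' xd by (intro exI[of _ "(H', K', r')"]) simp
  qed
  then obtain \<sigma> where \<sigma>: "\<forall>j. ?P j (\<sigma> j) \<and> ?Q j (\<sigma> j) (\<sigma> (Suc j))" ..
  have P: "?P j (\<sigma> j)" and Q: "?Q j (\<sigma> j) (\<sigma> (Suc j))" for j
    by (rule \<sigma>[THEN spec, THEN conjunct1], rule \<sigma>[THEN spec, THEN conjunct2])
  have second: "fst (snd (\<sigma> j)) = fst (\<sigma> (Suc j))" for j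
    using Q[of j] by (auto simp: case_prod_beta)
  show ?thesis
  proof (rule that[of "\<lambda>j. fst (\<sigma> j)" "\<lambda>j. snd (snd (\<sigma> j))"])
    fix j
    show "nodes (?e j) (fst (\<sigma> j))" "settled (snd (snd (\<sigma> j))) (?e j) (fst (\<sigma> j))"
      using P[of j] by (auto simp: case_prod_beta)
    show "snd (snd (\<sigma> j)) < snd (snd (\<sigma> (Suc j)))"
      "refines (snd (snd (\<sigma> (Suc j)))) (?e j) (fst (\<sigma> j)) (fst (\<sigma> (Suc (Suc j))))"
      using Q[of j] second[of "Suc j"] by (auto simp: case_prod_beta)
  qed
qed

text \<open>The levels \<open>2 * k + p\<close> form a Cantor scheme with intersection
  \<open>P p\<close>. An index in the block starting at \<open>r (2 * k + p)\<close> is past the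
  threshold of that level, yet below the bound up to which the next level of the scheme keeps
  \<open>f n\<close> nearly constant.\<close>

lemma perfect_uniform_limits:
  obtains r :: "nat \<Rightarrow> nat" and P :: "nat \<Rightarrow> real set" where "strict_mono r"
    "\<And>p. P p \<noteq> {}" "\<And>p. perfect_set (P p)"
    "\<And>p. uniform_limit (P p) f E (along (A \<inter> (\<Union>k. {r (2 * k + p)..<r (Suc (2 * k + p))})))"
proof -
  let ?e = "\<lambda>j. inverse (real (Suc j))"
  obtain X r where X: "\<And>j. nodes (?e j) (X j)" and settled: "\<And>j. settled (r j) (?e j) (X j)"
    and r: "\<And>j. r j < r (Suc j)" and ref: "\<And>j. refines (r (Suc j)) (?e j) (X j) (X (Suc (Suc j)))"
    using interleaved_levels by metis
  have mono: "strict_mono r" using r by (simp add: strict_mono_Suc_iff)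
  have node: "node (?e j) s" if "s \<in> X j" for j s
    using X[of j] that by (simp add: nodes_def)
  define F where "F p k = nball ` X (2 * k + p)" for p k
  define P where "P p = (\<Inter>k. \<Union>(F p k))" for p
  have e_le: "?e (2 * k + p) \<le> ?e k" for k p by (simp add: field_simps)
  have perf: "perfect_set (P p)" "P p \<noteq> {}" for p
  proof -
    have 1: "finite (F p k)" "F p k \<noteq> {}" for k
      using X[of "2 * k + p"] by (auto simp: F_def nodes_def)
    have 2: "compact S \<and> S \<noteq> {}" if "S \<in> F p k" for k S
      using that node by (force simp: F_def node_def)
    have 3: "\<exists>T\<in>F p k. S \<subseteq> T" if "S \<in> F p (Suc k)" for k S
      using that ref[of "2 * k + p"] by (fastforce simp: F_def refines_def child_def)
    have 4: "\<exists>T\<in>F p (Suc k). \<exists>T'\<in>F p (Suc k). T \<subseteq> S \<and> T' \<subseteq> S \<and> T \<inter> T' = {}"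
      if "S \<in> F p k" for k S
      using that ref[of "2 * k + p"] unfolding F_def refines_def by simp blast
    have 5: "dist x y \<le> 2 * ?e k" if S: "S \<in> F p k" and xy: "x \<in> S" "y \<in> S" for k S x y
    proof -
      obtain s where s: "s \<in> X (2 * k + p)" "S = nball s" using S by (auto simp: F_def)
      have "dist x y \<le> 2 * snd s"
        using xy s(2) dist_triangle2[of x y "fst s"] by (simp add: dist_commute)
      moreover have "snd s \<le> ?e (2 * k + p)" using node[OF s(1)] by (simp add: node_def)
      ultimately show ?thesis using e_le[of k p] by linarith
    qed
    have 6: "(\<lambda>k. 2 * ?e k) \<longlonglongrightarrow> 0"
      using tendsto_mult_left[OF LIMSEQ_inverse_real_of_nat, of 2] by simp
    show "perfect_set (P p)" "P p \<noteq> {}"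
      unfolding P_def using perfect_fusion[of "F p" "\<lambda>k. 2 * ?e k", OF 1 2 3 4 5 6] by simp_all
  qed
  have "uniform_limit (P p) f E (along (A \<inter> (\<Union>k. {r (2 * k + p)..<r (Suc (2 * k + p))})))" for p
    unfolding uniform_limit_iff eventually_along
  proof (intro allI impI)
    fix \<epsilon> :: real assume "0 < \<epsilon>"
    then obtain K where K: "?e K < \<epsilon> / 3"
      using reals_Archimedean[of "\<epsilon> / 3"] by auto
    have "dist (f n z) (E z) < \<epsilon>"
      if n: "n \<in> A" "r (2 * k + p) \<le> n" "n < r (Suc (2 * k + p))" "r (2 * K + p) \<le> n"
        and z: "z \<in> P p" for n k z
    proof -
      let ?j = "2 * k + p"
      \<comment> \<open>An index beyond \<open>r (2 * K + p)\<close> lies in a block at or after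
        that one, where the errors are at most \<open>?e K\<close>.\<close>
      have "2 * K + p < Suc ?j"
        using n(3,4) strict_mono_less[OF mono] by (metis le_less_trans)
      then have "?e ?j \<le> ?e K" by (simp add: field_simps)
      then have small: "?e ?j < \<epsilon> / 3" using K by linarith
      \<comment> \<open>The next level is needed because \<open>f n\<close> is controlled on the
        children of \<open>s\<close>, not on all of \<open>nball s\<close>.\<close>
      have "z \<in> \<Union>(F p (Suc k))" using z unfolding P_def by blast
      then obtain t where t: "t \<in> X (Suc (Suc ?j))" "z \<in> nball t" by (auto simp: F_def)
      then obtain s where s: "s \<in> X ?j" "child (r (Suc ?j)) (?e ?j) s t"
        using ref[of ?j] unfolding refines_def by blast
      have "\<bar>f n z - f n (fst s)\<bar> \<le> ?e ?j"
        using s(2) t(2) n(3) unfolding child_def by blast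
      moreover have "\<bar>f n (fst s) - g (fst s)\<bar> \<le> ?e ?j"
        using settled[of ?j] s(1) n(1,2) unfolding settled_def by blast
      moreover have "\<bar>E z - g (fst s)\<bar> \<le> ?e ?j"
        using node[OF s(1)] s(2) t(2) unfolding node_def child_def by blast
      ultimately show ?thesis using small unfolding dist_real_def by linarith
    qed
    then show "\<exists>N. \<forall>n\<in>A \<inter> (\<Union>k. {r (2 * k + p)..<r (Suc (2 * k + p))}). N \<le> n \<longrightarrow>
        (\<forall>z\<in>P p. dist (f n z) (E z) < \<epsilon>)"
      by (intro exI[of _ "r (2 * K + p)"]) auto
  qed
  then show ?thesis using that mono perf by blast
qed

end

section \<open>Choosing a positive part, and the equivalence\<close>

lemma ideal_pos_cover:
  assumes I: "is_ideal I" and A: "A \<in> ideal_pos I" and sub: "A \<subseteq> F \<union> B \<union> C" and fin: "finite F"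
  shows "B \<in> ideal_pos I \<or> C \<in> ideal_pos I"
proof (rule ccontr)
  assume "\<not> ?thesis"
  then have "F \<union> B \<union> C \<in> I"
    using I fin unfolding is_ideal_def ideal_pos_def by simp
  then show False
    using I A sub unfolding is_ideal_def ideal_pos_def by blast
qed

text \<open>From \<open>r 0\<close> on, each index lies in a block between consecutive thresholds,
  and the parity of the block decides the scheme.\<close>

lemma strict_mono_alternating_cover:
  fixes r :: "nat \<Rightarrow> nat"
  assumes r: "strict_mono r"
  shows "n < r 0 \<or> (\<exists>k. n \<in> {r (2 * k)..<r (Suc (2 * k))}) \<or>
    (\<exists>k. n \<in> {r (2 * k + 1)..<r (Suc (2 * k + 1))})"
proof (cases "n < r 0")
  case False
  have "\<exists>j. n < r j"
    using strict_mono_imp_increasing[OF r, of "Suc n"] by (meson Suc_le_lessD)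
  then obtain j where j: "n < r j" "\<And>i. i < j \<Longrightarrow> \<not> n < r i"
    using exists_least_iff[of "\<lambda>j. n < r j"] by blast
  obtain i where i: "j = Suc i" using j(1) False by (cases j) auto
  have n: "r i \<le> n" "n < r (Suc i)" using j(1) j(2)[of i] i by auto
  obtain k where "i = 2 * k \<or> i = 2 * k + 1" by (metis oddE evenE)
  then show ?thesis
  proof
    assume "i = 2 * k"
    then have "n \<in> {r (2 * k)..<r (Suc (2 * k))}" using n by simp
    then show ?thesis by blast
  next
    assume "i = 2 * k + 1"
    then have "n \<in> {r (2 * k + 1)..<r (Suc (2 * k + 1))}" using n by simp
    then show ?thesis by blast
  qed
qed simp

lemma FinBW_imp_uniformly_convergent_on_perfect:
  fixes f :: "nat \<Rightarrow> real \<Rightarrow> real"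
  assumes I: "is_ideal I" "FinBW I" and cont: "\<And>n. continuous_on UNIV (f n)"
    and bdd: "\<And>n x. \<bar>f n x\<bar> \<le> M"
  shows "\<exists>A\<in>ideal_pos I. \<exists>P. P \<noteq> {} \<and> perfect_set P \<and> uniformly_convergent_on P (subseq_on f A)"
proof -
  \<comment> \<open>Once these sets are decided along \<open>A\<close>, every rational cut of
    \<open>f n q\<close> is decided, which gives a limit at each rational \<open>q\<close>.\<close>
  have "countable ((\<lambda>(q, r). {n. r \<le> f n q}) ` (\<rat> \<times> \<rat>))"
    by (intro countable_image countable_SIGMA countable_rat)
  then obtain A where A: "A \<in> ideal_pos I"
    and dec: "\<And>S. S \<in> (\<lambda>(q, r). {n. r \<le> f n q}) ` (\<rat> \<times> \<rat>) \<Longrightarrow>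
      (\<forall>\<^sub>F n in along A. n \<in> S) \<or> (\<forall>\<^sub>F n in along A. n \<notin> S)"
    using FinBW_splitting[OF I] by metis
  have bot: "along A \<noteq> bot"
    using ideal_pos_infinite[OF I(1) A] by (rule along_neq_bot)
  have "\<exists>l. ((\<lambda>n. f n q) \<longlongrightarrow> l) (along A)" if q: "q \<in> \<rat>" for q
  proof (rule tendsto_of_thresholds[OF bot bdd])
    fix r :: real assume "r \<in> \<rat>"
    then have "{n. r \<le> f n q} \<in> (\<lambda>(q, r). {n. r \<le> f n q}) ` (\<rat> \<times> \<rat>)"
      using q by (intro image_eqI[of _ _ "(q, r)"]) auto
    from dec[OF this] show "(\<forall>\<^sub>F n in along A. r \<le> f n q) \<or> (\<forall>\<^sub>F n in along A. \<not> r \<le> f n q)"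
      by simp
  qed
  then obtain g where g: "\<And>q. q \<in> \<rat> \<Longrightarrow> ((\<lambda>n. f n q) \<longlongrightarrow> g q) (along A)" by metis
  have gM: "\<bar>g q\<bar> \<le> M" if "q \<in> \<rat>" for q
    using tendsto_upperbound[OF tendsto_rabs[OF g[OF that]] _ bot] bdd by simp
  have dense: "U \<inter> \<rat> \<noteq> {}" if "open U" "U \<noteq> {}" for U :: "real set"
    using that open_Int_closure_eq_empty[of U "\<rat>"] by (simp add: Rats_closure_real)
  obtain E where E: "\<forall>U e. open U \<longrightarrow> U \<noteq> {} \<longrightarrow> 0 < e \<longrightarrow>
      (\<exists>y\<in>\<rat>. \<exists>d>0. cball y d \<subseteq> U \<and> (\<forall>z\<in>cball y d. \<bar>E z - g y\<bar> \<le> e))"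
    using almost_continuous_envelope[of "\<rat>" g M, OF dense gM] ..
  interpret interleaved_fusion f g E "\<rat>" A
  proof
    show "continuous_on UNIV (f n)" for n by (rule cont)
    show "((\<lambda>n. f n q) \<longlongrightarrow> g q) (along A)" if "q \<in> \<rat>" for q using that by (rule g)
    show "\<exists>y\<in>\<rat>. \<exists>d>0. cball y d \<subseteq> U \<and> (\<forall>z\<in>cball y d. \<bar>E z - g y\<bar> \<le> e)"
      if "open U" "U \<noteq> {}" "0 < e" for U e using E that by simp
  qed
  obtain r P where r: "strict_mono r" and P: "\<And>p. P p \<noteq> {}" "\<And>p. perfect_set (P p)"
    and ul: "\<And>p. uniform_limit (P p) f E
      (along (A \<inter> (\<Union>k. {r (2 * k + p)..<r (Suc (2 * k + p))})))"
    by (rule perfect_uniform_limits) (rule that)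
  define B where "B p = A \<inter> (\<Union>k. {r (2 * k + p)..<r (Suc (2 * k + p))})" for p
  \<comment> \<open>The indices below \<open>r 0\<close> precede both schemes, but they are finitely
    many and hence negligible for the ideal.\<close>
  have "A \<subseteq> {..<r 0} \<union> B 0 \<union> B 1"
    using strict_mono_alternating_cover[OF r] unfolding B_def by fastforce
  then obtain p where p: "B p \<in> ideal_pos I"
    using ideal_pos_cover[OF I(1) A] by blast
  have "uniform_limit (P p) f E (along (B p))"
    unfolding B_def by (rule ul)
  \<comment> \<open>Positivity of \<open>B p\<close> makes it infinite, so its increasing
    enumeration can be composed with the limit.\<close>
  then have "uniform_limit (P p) (subseq_on f (B p)) E sequentially"
    unfolding subseq_on_def
    by (rule filterlim_compose[OF _ filterlim_enumerate[OF ideal_pos_infinite[OF I(1) p]]])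
  then have "uniformly_convergent_on (P p) (subseq_on f (B p))"
    by (rule uniformly_convergentI)
  then show ?thesis
    using p P[of p] by (intro bexI[of _ "B p"] exI[of _ "P p"] conjI)
qed

theorem theorem7p1:
  fixes I :: "nat set set"
  assumes "is_ideal I"
  shows "FinBW I \<longleftrightarrow>
    (\<forall>f :: nat \<Rightarrow> real \<Rightarrow> real.
       (\<forall>n. continuous_on UNIV (f n)) \<and> (\<exists>M. \<forall>n x. \<bar>f n x\<bar> \<le> M) \<longrightarrow>
       (\<exists>A \<in> ideal_pos I. \<exists>P. P \<noteq> {} \<and> perfect_set P \<and>
          uniformly_convergent_on P (subseq_on f A)))"
    (is "_ \<longleftrightarrow> ?R")
proof
  assume "FinBW I"
  then show ?R
    using FinBW_imp_uniformly_convergent_on_perfect[OF assms] by blast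
next
  assume R: ?R
  show "FinBW I"
    unfolding FinBW_def
  proof (intro allI impI)
    fix x :: "nat \<Rightarrow> real" assume "\<forall>n. x n \<in> {0..1}"
    then have bdd: "\<forall>n (y::real). \<bar>x n\<bar> \<le> 1" by simp
    \<comment> \<open>Apply the hypothesis to the constant functions with values \<open>x n\<close>;
      evaluation at a point of \<open>P\<close> then recovers the subsequence of
      \<open>x\<close>.\<close>
    have "\<exists>A\<in>ideal_pos I. \<exists>P. P \<noteq> {} \<and> perfect_set P \<and>
        uniformly_convergent_on P (subseq_on (\<lambda>n _. x n) A)"
      using R[THEN spec[of _ "\<lambda>n _. x n"]] bdd by (simp, blast)
    then obtain A where A: "A \<in> ideal_pos I"
      and "\<exists>P. P \<noteq> {} \<and> perfect_set P \<and> uniformly_convergent_on P (subseq_on (\<lambda>n _. x n) A)" ..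
    then obtain P
      where P: "P \<noteq> {} \<and> perfect_set P \<and> uniformly_convergent_on P (subseq_on (\<lambda>n _. x n) A)"
      by (elim exE)
    then obtain z where "z \<in> P" by auto
    with P have "convergent (\<lambda>k. subseq_on (\<lambda>n _. x n) A k z)"
      by (intro uniformly_convergent_imp_convergent) simp_all
    then show "\<exists>A\<in>ideal_pos I. convergent (subseq_on x A)"
      using A by (auto simp: subseq_on_def)
  qed
qed

end
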